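(* Let $n,m$ be nonnegative integers with $n+m\neq 0$. Then the collection $\{(U_{ij},\phi_{ij})\mid 0\le i\le n,\ 0\le j\le m\}$ is an $\mathcal{R}^{(2)}$-smooth atlas on the real projective $\mathcal{R}^{(2)}$-module $\mathcal{R}^{(2)}\mathcal{P}^{n,m}$, and $\mathcal{R}^{(2)}\mathcal{P}^{n,m}$ is an $(n,m)$-dimensional $\mathcal{R}^{(2)}$-smooth zero divisor manifold.
   Context: Let $\mathcal{R}$ be the field of real numbers. The dual real number algebra is the 2-dimensional commutative associative real algebra $\mathcal{R}^{(2)}=\mathcal{R}\oplus\mathcal{R}\,1^{\#}$ with basis $\{1,1^{\#}\}$ and product $(x_1+x_2 1^{\#})(y_1+y_2 1^{\#})=x_1y_1+(x_1y_2+x_2y_1)1^{\#}$ for $x_1,x_2,y_1,y_2\in\mathcal{R}$. For $x=x_1+x_21^{\#}$ with $x_1,x_2\in\mathcal{R}$, $Re\,x:=x_1$ and $Ze\,x:=x_2$. An element $x$ is invertible iff $Re\,x\ne0$, and then $\frac{y}{x}:=x^{-1}y$. All superscripts on coordinates below are indices. For nonnegative integers $n,m$ with $n+m\ne 0$, $\mathcal{R}^{(2)n,m}$ is the $\mathcal{R}^{(2)}$-module of all tuples $(x^1,\dots,x^n\,|\,x^{n+1}1^{\#},\dots,x^{n+m}1^{\#})$ with $x^1,\dots,x^n\in\mathcal{R}^{(2)}$ and $x^{n+1},\dots,x^{n+m}\in\mathcal{R}$, with coordinatewise operations. Writing $x^i=x^{i1}+1^{\#}x^{i2}$ with $x^{i1},x^{i2}\in\mathcal{R}$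 for $1\le i\le n$, it carries the metric topology of the norm $\|x\|=\sqrt{\langle x,x\rangle}$, where $\langle x,y\rangle=2\sum_{i=1}^n x^{i1}y^{i1}+\sum_{i=1}^n x^{i2}y^{i2}+\sum_{j=1}^m x^{n+j}y^{n+j}$. A function $f$ from an open subset of $\mathcal{R}^{(2)n,m}$ to $\mathcal{R}^{(2)}$ is $\mathcal{R}^{(2)}$-smooth if $Re\,f$ and $Ze\,f$ are smooth ($C^\infty$) as real-valued functions of the $2n+m$ real variables $x^{11},\dots,x^{n1},x^{12},\dots,x^{n2},x^{n+1},\dots,x^{n+m}$. A function into $\mathcal{R}^{(2)s,t}$ is $\mathcal{R}^{(2)}$-smooth if all its component functions $f^1,\dots,f^{s+t}$ are $\mathcal{R}^{(2)}$-smooth. A Hausdorff topological space $M$ is an $(n,m)$-dimensional $\mathcal{R}^{(2)}$-smooth zero divisor manifold if there are open subsets $U_\lambda$ of $M$ ($\lambda\in\Lambda$, with $\Lambda$ finite or countable) and maps $\Phi_\lambda:U_\lambda\to\mathcal{R}^{(2)n,m}$ such that: (i) $M=\bigcup_{\lambda\in\Lambda}U_\lambda$; (ii) each image $\Phi_\lambda(U_\lambda)$ is open in $\mathcal{R}^{(2)n,m}$; (iii) each $\Phi_\lambda$ is one-to-one; (iv) for all $\lambda,\mu\in\Lambda$ the images $\Phi_\lambda(U_\lambda\cap U_\mu)$ and $\Phi_\mu(U_\lambda\cap U_\mu)$ are open in $\mathcal{R}^{(2)n,m}$ and the transition map $\Phi_\mu\circ\Phi_\lambda^{-1}:\Phi_\lambda(U_\lambda\cap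 U_\mu)\to\Phi_\mu(U_\lambda\cap U_\mu)$ is $\mathcal{R}^{(2)}$-smooth. The collection $\{(U_\lambda,\Phi_\lambda)\mid\lambda\in\Lambda\}$ is then called an $\mathcal{R}^{(2)}$-smooth atlas. Construction of $\mathcal{R}^{(2)}\mathcal{P}^{n,m}$: write elements of $\mathcal{R}^{(2)(n+1),m+1}$ as $x=(x^0,\dots,x^n\,|\,x^{n+1}1^{\#},\dots,x^{n+m+1}1^{\#})$ with $x^0,\dots,x^n\in\mathcal{R}^{(2)}$ and $x^{n+1},\dots,x^{n+m+1}\in\mathcal{R}$. Let $V$ be the subset of those $x$ with $Re\,x^i=0$ for all $0\le i\le n$, and let $W$ be the subset of those $x$ with $x^{n+1+j}=0$ for all $0\le j\le m$. Put $\overline{\mathcal{R}^{(2)(n+1),m+1}}:=\mathcal{R}^{(2)(n+1),m+1}\setminus(V\cup W)$ with the subspace topology. On it define the equivalence relation: $x\sim y$ iff there exist $s\in\mathcal{R}^{(2)}$ with $Re\,s\neq0$ and $t\in\mathcal{R}$ with $t\neq0$ such that $y^i=s\,x^i$ for $0\le i\le n$ and $y^{n+1+j}=t\,x^{n+1+j}$ for $0\le j\le m$. The real projective $\mathcal{R}^{(2)}$-module is the quotient space $\mathcal{R}^{(2)}\mathcal{P}^{n,m}:=\overline{\mathcal{R}^{(2)(n+1),m+1}}/\sim$ (quotient topology), and $[x]$ denotes the class of $x$. For $0\le i\le n$ and $0\le j\le m$, let $U_{ij}:=\{[x]\mid Re\,x^i\neq0 \text{ and } x^{n+1+j}\neq0\}$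 and define $\phi_{ij}:U_{ij}\to\mathcal{R}^{(2)n,m}$ by $$\phi_{ij}([x])=\left(\frac{x^0}{x^i},\dots,\widehat{\frac{x^i}{x^i}},\dots,\frac{x^n}{x^i}\ \Big|\ \frac{x^{n+1}}{x^{n+1+j}}1^{\#},\dots,\widehat{\frac{x^{n+1+j}}{x^{n+1+j}}1^{\#}},\dots,\frac{x^{n+m+1}}{x^{n+1+j}}1^{\#}\right),$$ where a hat means that the entry is omitted. *)

theory Defs
  imports "HOL-Analysis.Analysis"
begin

datatype dual = Dual (re: real) (ze: real)

lemma dual_eq_iff: "x = y \<longleftrightarrow> re x = re y \<and> ze x = ze y"
  by (cases x; cases y) auto

instantiation dual :: "{comm_ring_1, real_algebra_1, inverse}"
begin

definition "0 = Dual 0 0"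
definition "1 = Dual 1 0"
definition "x + y = Dual (re x + re y) (ze x + ze y)"
definition "x - y = Dual (re x - re y) (ze x - ze y)"
definition "- x = Dual (- re x) (- ze x)"
definition "x * y = Dual (re x * re y) (re x * ze y + ze x * re y)"
definition "c *\<^sub>R x = Dual (c * re x) (c * ze x)"
(* meaningful only for re x \<noteq> 0; see inverse_dual below *)
definition "inverse x = Dual (1 / re x) (- ze x / (re x)\<^sup>2)"
definition divide_dual :: "dual \<Rightarrow> dual \<Rightarrow> dual" where "divide_dual y x = inverse x * y"

instance
  by standard
    (simp_all add: dual_eq_iff zero_dual_def one_dual_def plus_dual_def minus_dual_def
      uminus_dual_def times_dual_def scaleR_dual_def algebra_simps)

end

definition zd_unit :: dual  (* the basis element 1^# *)
  where "zd_unit = Dual 0 1"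

lemma dual_expand: "x = re x *\<^sub>R 1 + ze x *\<^sub>R zd_unit"
  by (simp add: dual_eq_iff plus_dual_def scaleR_dual_def one_dual_def zd_unit_def)

lemma inverse_dual:
  fixes x :: dual
  assumes "re x \<noteq> 0"
  shows "x * inverse x = 1"
  using assms by (simp add: dual_eq_iff times_dual_def inverse_dual_def one_dual_def power2_eq_square)

lemma invertible_dual_iff:
  fixes x :: dual
  shows "(\<exists>y. x * y = 1) \<longleftrightarrow> re x \<noteq> 0"
  using inverse_dual by (fastforce simp: times_dual_def one_dual_def)

text \<open>
  A tuple in the module with \<open>n\<close> dual coordinates and \<open>m\<close> coordinates in the real multiples of
  \<^term>\<open>zd_unit\<close> is a function on the indices \<open>0, \<dots>, n + m - 1\<close>, extended by \<open>0\<close>.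
  The real number standing at index \<open>k\<close> of the second block, \<open>n \<le> k < n + m\<close>, is
  \<open>ze (x k)\<close>.
\<close>

type_synonym tuple = "nat \<Rightarrow> dual"

definition zd_space :: "nat \<Rightarrow> nat \<Rightarrow> tuple set" where
  "zd_space n m = {x. (\<forall>k. n \<le> k \<and> k < n + m \<longrightarrow> re (x k) = 0) \<and> (\<forall>k\<ge>n + m. x k = 0)}"

definition zd_inner :: "nat \<Rightarrow> nat \<Rightarrow> tuple \<Rightarrow> tuple \<Rightarrow> real" where
  "zd_inner n m x y =
     2 * (\<Sum>k<n. re (x k) * re (y k)) + (\<Sum>k<n. ze (x k) * ze (y k))
     + (\<Sum>j<m. ze (x (n + j)) * ze (y (n + j)))"

definition zd_norm :: "nat \<Rightarrow> nat \<Rightarrow> tuple \<Rightarrow> real" where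
  "zd_norm n m x = sqrt (zd_inner n m x x)"

definition zd_dist :: "nat \<Rightarrow> nat \<Rightarrow> tuple \<Rightarrow> tuple \<Rightarrow> real" where
  "zd_dist n m x y = zd_norm n m (\<lambda>k. x k - y k)"

definition zd_topology :: "nat \<Rightarrow> nat \<Rightarrow> tuple topology" where
  "zd_topology n m = Metric_space.mtopology (zd_space n m) (zd_dist n m)"

lemma zd_dist_L2_set:
  "zd_dist n m x y =
     L2_set (\<lambda>i. case i of Inl k \<Rightarrow> sqrt 2 * (re (x k) - re (y k)) | Inr k \<Rightarrow> ze (x k) - ze (y k))
       ({..<n} <+> {..<n + m})"
proof -
  have "(\<Sum>k<n + m. f k) = (\<Sum>k<n. f k) + (\<Sum>j<m. f (n + j))" for f :: "nat \<Rightarrow> real"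
    by (induction m) (simp_all add: algebra_simps)
  then show ?thesis
    by (simp add: zd_dist_def zd_norm_def zd_inner_def L2_set_def sum.Plus power_mult_distrib
        minus_dual_def sum_distrib_left flip: power2_eq_square)
qed

lemma Metric_space_zd: "Metric_space (zd_space n m) (zd_dist n m)"
proof
  fix x y z :: tuple
  let ?I = "{..<n} <+> {..<n + m}"
  let ?D = "\<lambda>x y i. case i of Inl k \<Rightarrow> sqrt 2 * (re (x k) - re (y k)) | Inr k \<Rightarrow> ze (x k) - ze (y k)"
  show "0 \<le> zd_dist n m x y"
    by (simp add: zd_dist_L2_set)
  show "zd_dist n m x y = zd_dist n m y x"
    unfolding zd_dist_L2_set L2_set_def
    by (intro arg_cong[of _ _ sqrt] sum.cong)
      (auto split: sum.split simp: power2_eq_square algebra_simps)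
  show "zd_dist n m x y = 0 \<longleftrightarrow> x = y" if "x \<in> zd_space n m" "y \<in> zd_space n m"
  proof
    assume "zd_dist n m x y = 0"
    then have D: "\<forall>i\<in>?I. ?D x y i = 0"
      unfolding zd_dist_L2_set by (subst (asm) L2_set_eq_0_iff) auto
    show "x = y"
    proof
      fix k
      have "re (x k) = re (y k)" if "k < n"
        using bspec[OF D, of "Inl k"] that by auto
      moreover have "ze (x k) = ze (y k)" if "k < n + m"
        using bspec[OF D, of "Inr k"] that by auto
      ultimately show "x k = y k"
        using that unfolding zd_space_def dual_eq_iff
        by (cases "k < n"; cases "k < n + m") auto
    qed
  qed (simp add: zd_dist_L2_set L2_set_def sum.neutral split: sum.split)
  show "zd_dist n m x z \<le> zd_dist n m x y + zd_dist n m y z"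
  proof -
    have "?D x z = (\<lambda>i. ?D x y i + ?D y z i)"
      by (auto simp: fun_eq_iff algebra_simps split: sum.split)
    then show ?thesis
      unfolding zd_dist_L2_set using L2_set_triangle_ineq[of "?D x y" "?D y z" ?I] by simp
  qed
qed

lemma topspace_zd [simp]: "topspace (zd_topology n m) = zd_space n m"
  by (simp add: zd_topology_def Metric_space.topspace_mtopology[OF Metric_space_zd])

text \<open>The unit vectors of the \<open>2 * n + m\<close> real coordinates.\<close>

definition zd_dirs :: "nat \<Rightarrow> nat \<Rightarrow> tuple set" where
  "zd_dirs n m = {(\<lambda>_. 0)(k := 1) | k. k < n} \<union> {(\<lambda>_. 0)(k := zd_unit) | k. k < n + m}"

definition zd_line :: "tuple \<Rightarrow> tuple \<Rightarrow> real \<Rightarrow> tuple" where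
  "zd_line x e h = (\<lambda>k. x k + h *\<^sub>R e k)"

definition partial_deriv :: "tuple \<Rightarrow> (tuple \<Rightarrow> real) \<Rightarrow> tuple \<Rightarrow> real" where
  "partial_deriv e f x = deriv (\<lambda>h. f (zd_line x e h)) 0"

fun Ck_on :: "nat \<Rightarrow> nat \<Rightarrow> nat \<Rightarrow> tuple set \<Rightarrow> (tuple \<Rightarrow> real) \<Rightarrow> bool" where
  "Ck_on n m 0 S f \<longleftrightarrow> continuous_map (subtopology (zd_topology n m) S) euclideanreal f"
| "Ck_on n m (Suc r) S f \<longleftrightarrow>
     continuous_map (subtopology (zd_topology n m) S) euclideanreal f \<and>
     (\<forall>e\<in>zd_dirs n m.
        (\<forall>x\<in>S. (\<lambda>h. f (zd_line x e h)) differentiable at 0) \<and>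
        Ck_on n m r S (partial_deriv e f))"

definition real_smooth_on :: "nat \<Rightarrow> nat \<Rightarrow> tuple set \<Rightarrow> (tuple \<Rightarrow> real) \<Rightarrow> bool" where
  "real_smooth_on n m S f \<longleftrightarrow> openin (zd_topology n m) S \<and> (\<forall>r. Ck_on n m r S f)"

definition dual_smooth_on :: "nat \<Rightarrow> nat \<Rightarrow> tuple set \<Rightarrow> (tuple \<Rightarrow> dual) \<Rightarrow> bool" where
  "dual_smooth_on n m S f \<longleftrightarrow>
     real_smooth_on n m S (\<lambda>x. re (f x)) \<and> real_smooth_on n m S (\<lambda>x. ze (f x))"

definition zd_smooth_on ::
    "nat \<Rightarrow> nat \<Rightarrow> nat \<Rightarrow> nat \<Rightarrow> tuple set \<Rightarrow> (tuple \<Rightarrow> tuple) \<Rightarrow> bool" where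
  "zd_smooth_on n m s t S F \<longleftrightarrow>
     F ` S \<subseteq> zd_space s t \<and> (\<forall>k<s + t. dual_smooth_on n m S (\<lambda>x. F x k))"

text \<open>
  A chart is a pair of its domain and a map that matters only on this domain.  As in the source,
  charts are not required to be homeomorphisms.
\<close>

definition zd_smooth_atlas ::
    "nat \<Rightarrow> nat \<Rightarrow> 'a topology \<Rightarrow> ('a set \<times> ('a \<Rightarrow> tuple)) set \<Rightarrow> bool" where
  "zd_smooth_atlas n m M A \<longleftrightarrow>
     countable A \<and>
     (\<forall>(U, \<Phi>)\<in>A. openin M U) \<and>
     topspace M = (\<Union>(U, \<Phi>)\<in>A. U) \<and>
     (\<forall>(U, \<Phi>)\<in>A. openin (zd_topology n m) (\<Phi> ` U)) \<and>
     (\<forall>(U, \<Phi>)\<in>A. inj_on \<Phi> U) \<and>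
     (\<forall>(U, \<Phi>)\<in>A. \<forall>(U', \<Phi>')\<in>A.
        openin (zd_topology n m) (\<Phi> ` (U \<inter> U')) \<and>
        openin (zd_topology n m) (\<Phi>' ` (U \<inter> U')) \<and>
        zd_smooth_on n m n m (\<Phi> ` (U \<inter> U')) (\<Phi>' \<circ> the_inv_into U \<Phi>))"

definition zd_smooth_manifold :: "nat \<Rightarrow> nat \<Rightarrow> 'a topology \<Rightarrow> bool" where
  "zd_smooth_manifold n m M \<longleftrightarrow> Hausdorff_space M \<and> (\<exists>A. zd_smooth_atlas n m M A)"

definition quotient_topology :: "'a topology \<Rightarrow> ('a \<times> 'a) set \<Rightarrow> 'a set topology" where
  "quotient_topology X r =
     topology (\<lambda>\<U>. \<U> \<subseteq> topspace X // r \<and> openin X {x \<in> topspace X. r `` {x} \<in> \<U>})"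

lemma openin_quotient_topology:
  "openin (quotient_topology X r) \<U> \<longleftrightarrow>
     \<U> \<subseteq> topspace X // r \<and> openin X {x \<in> topspace X. r `` {x} \<in> \<U>}"
proof -
  let ?P = "\<lambda>\<U>. \<U> \<subseteq> topspace X // r \<and> openin X {x \<in> topspace X. r `` {x} \<in> \<U>}"
  have "?P (S \<inter> T)" if "?P S" "?P T" for S T
  proof -
    have "{x \<in> topspace X. r `` {x} \<in> S \<inter> T} =
        {x \<in> topspace X. r `` {x} \<in> S} \<inter> {x \<in> topspace X. r `` {x} \<in> T}"
      by blast
    with that show ?thesis by auto
  qed
  moreover have "?P (\<Union>K)" if "\<forall>S\<in>K. ?P S" for K
  proof -
    have "{x \<in> topspace X. r `` {x} \<in> \<Union>K} = (\<Union>S\<in>K. {x \<in> topspace X. r `` {x} \<in> S})"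
      by blast
    with that show ?thesis by (auto intro!: openin_Union)
  qed
  ultimately have "istopology ?P"
    unfolding istopology_def by blast
  then show ?thesis
    by (simp add: quotient_topology_def topology_inverse')
qed

lemma topspace_quotient_topology [simp]: "topspace (quotient_topology X r) = topspace X // r"
proof
  show "topspace (quotient_topology X r) \<subseteq> topspace X // r"
    using openin_topspace[of "quotient_topology X r"] unfolding openin_quotient_topology by blast
  have "{x \<in> topspace X. r `` {x} \<in> topspace X // r} = topspace X"
    by (auto intro: quotientI)
  then show "topspace X // r \<subseteq> topspace (quotient_topology X r)"
    by (intro openin_subset) (simp add: openin_quotient_topology)
qed

lemma quotient_map_quotient_topology:
  "quotient_map X (quotient_topology X r) (\<lambda>x. r `` {x})"
  by (auto simp: quotient_map_def openin_quotient_topology quotient_def)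

definition zd_V :: "nat \<Rightarrow> nat \<Rightarrow> tuple set" where
  "zd_V n m = {x \<in> zd_space (n + 1) (m + 1). \<forall>i\<le>n. re (x i) = 0}"

definition zd_W :: "nat \<Rightarrow> nat \<Rightarrow> tuple set" where
  "zd_W n m = {x \<in> zd_space (n + 1) (m + 1). \<forall>j\<le>m. ze (x (n + 1 + j)) = 0}"

definition zd_punctured :: "nat \<Rightarrow> nat \<Rightarrow> tuple set" where
  "zd_punctured n m = zd_space (n + 1) (m + 1) - (zd_V n m \<union> zd_W n m)"

definition proj_rel :: "nat \<Rightarrow> nat \<Rightarrow> (tuple \<times> tuple) set" where
  "proj_rel n m = {(x, y). x \<in> zd_punctured n m \<and> y \<in> zd_punctured n m \<and>
     (\<exists>s t. re s \<noteq> 0 \<and> t \<noteq> 0 \<and>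
        (\<forall>i\<le>n. y i = s * x i) \<and>
        (\<forall>j\<le>m. ze (y (n + 1 + j)) = t * ze (x (n + 1 + j))))}"

lemma equiv_proj_rel: "equiv (zd_punctured n m) (proj_rel n m)"
proof (rule equivI)
  show "proj_rel n m \<subseteq> zd_punctured n m \<times> zd_punctured n m"
    by (auto simp: proj_rel_def)
  show "refl_on (zd_punctured n m) (proj_rel n m)"
  proof (rule refl_onI)
    fix x assume "x \<in> zd_punctured n m"
    then show "(x, x) \<in> proj_rel n m"
      unfolding proj_rel_def by (auto intro!: exI[of _ 1] simp: one_dual_def[THEN arg_cong, of re])
  qed
  show "sym (proj_rel n m)"
  proof (rule symI)
    fix x y assume "(x, y) \<in> proj_rel n m"
    then obtain s t where *: "x \<in> zd_punctured n m" "y \<in> zd_punctured n m" "re s \<noteq> 0" "t \<noteq> 0"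
      "\<forall>i\<le>n. y i = s * x i" "\<forall>j\<le>m. ze (y (n + 1 + j)) = t * ze (x (n + 1 + j))"
      unfolding proj_rel_def by blast
    have "x i = inverse s * y i" if "i \<le> n" for i
    proof -
      have "inverse s * (s * x i) = (s * inverse s) * x i"
        by (simp only: mult.assoc mult.left_commute)
      then show ?thesis
        using * that by (simp add: inverse_dual)
    qed
    moreover have "re (inverse s) \<noteq> 0"
      using * by (simp add: inverse_dual_def)
    moreover have "ze (x (n + 1 + j)) = inverse t * ze (y (n + 1 + j))" if "j \<le> m" for j
      using * that by simp
    ultimately show "(y, x) \<in> proj_rel n m"
      unfolding proj_rel_def using * nonzero_imp_inverse_nonzero by blast
  qed
  show "trans (proj_rel n m)"
  proof (rule transI)
    fix x y z assume "(x, y) \<in> proj_rel n m" and "(y, z) \<in> proj_rel n m"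
    then obtain s t s' t' where *: "x \<in> zd_punctured n m" "z \<in> zd_punctured n m"
      "re s \<noteq> 0" "t \<noteq> 0" "re s' \<noteq> 0" "t' \<noteq> 0"
      "\<forall>i\<le>n. y i = s * x i" "\<forall>j\<le>m. ze (y (n + 1 + j)) = t * ze (x (n + 1 + j))"
      "\<forall>i\<le>n. z i = s' * y i" "\<forall>j\<le>m. ze (z (n + 1 + j)) = t' * ze (y (n + 1 + j))"
      unfolding proj_rel_def by blast
    have "re (s' * s) \<noteq> 0" "t' * t \<noteq> 0"
      using * by (simp_all add: times_dual_def)
    moreover have "\<forall>i\<le>n. z i = s' * s * x i" "\<forall>j\<le>m. ze (z (n + 1 + j)) = t' * t * ze (x (n + 1 + j))"
      using * by (simp_all add: mult.assoc)
    ultimately show "(x, z) \<in> proj_rel n m"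
      unfolding proj_rel_def using * by blast
  qed
qed

definition proj_module :: "nat \<Rightarrow> nat \<Rightarrow> tuple set topology" where
  "proj_module n m =
     quotient_topology (subtopology (zd_topology (n + 1) (m + 1)) (zd_punctured n m)) (proj_rel n m)"

lemma topspace_proj_module: "topspace (proj_module n m) = zd_punctured n m // proj_rel n m"
proof -
  have "zd_space (n + 1) (m + 1) \<inter> zd_punctured n m = zd_punctured n m"
    by (auto simp: zd_punctured_def)
  then show ?thesis
    by (simp add: proj_module_def)
qed

definition proj_class :: "nat \<Rightarrow> nat \<Rightarrow> tuple \<Rightarrow> tuple set" where
  "proj_class n m x = proj_rel n m `` {x}"

definition proj_U :: "nat \<Rightarrow> nat \<Rightarrow> nat \<Rightarrow> nat \<Rightarrow> tuple set set" where
  "proj_U n m i j =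
     {proj_class n m x | x. x \<in> zd_punctured n m \<and> re (x i) \<noteq> 0 \<and> ze (x (n + 1 + j)) \<noteq> 0}"

text \<open>\<open>skip i\<close> enumerates the natural numbers other than \<open>i\<close> in increasing order.\<close>

definition skip :: "nat \<Rightarrow> nat \<Rightarrow> nat" where
  "skip i k = (if k < i then k else k + 1)"

definition proj_coords :: "nat \<Rightarrow> nat \<Rightarrow> nat \<Rightarrow> nat \<Rightarrow> tuple \<Rightarrow> tuple" where
  "proj_coords n m i j x =
     (\<lambda>k. if k < n then x (skip i k) / x i
          else if k < n + m
          then (ze (x (n + 1 + skip j (k - n))) / ze (x (n + 1 + j))) *\<^sub>R zd_unit
          else 0)"

text \<open>The common value of \<^const>\<open>proj_coords\<close> on all representatives of a class.\<close>

definition proj_chart :: "nat \<Rightarrow> nat \<Rightarrow> nat \<Rightarrow> nat \<Rightarrow> tuple set \<Rightarrow> tuple" where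
  "proj_chart n m i j c = the_elem (proj_coords n m i j ` c)"

lemma proj_chart_class:
  assumes "x \<in> zd_punctured n m" "i \<le> n" "j \<le> m" "re (x i) \<noteq> 0" "ze (x (n + 1 + j)) \<noteq> 0"
  shows "proj_chart n m i j (proj_class n m x) = proj_coords n m i j x"
proof -
  have "proj_coords n m i j y = proj_coords n m i j x" if "(x, y) \<in> proj_rel n m" for y
  proof -
    obtain s t where st: "re s \<noteq> 0" "t \<noteq> 0" "\<forall>i\<le>n. y i = s * x i"
      "\<forall>j\<le>m. ze (y (n + 1 + j)) = t * ze (x (n + 1 + j))"
      using \<open>(x, y) \<in> proj_rel n m\<close> unfolding proj_rel_def by blast
    have "y (skip i k) / y i = x (skip i k) / x i" if "k < n" for k
    proof -
      have "skip i k \<le> n"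
        using that by (simp add: skip_def)
      then show ?thesis
        using st assms
        by (simp add: dual_eq_iff divide_dual_def inverse_dual_def times_dual_def field_simps
            power2_eq_square)
    qed
    moreover have "ze (y (n + 1 + skip j (k - n))) / ze (y (n + 1 + j)) =
        ze (x (n + 1 + skip j (k - n))) / ze (x (n + 1 + j))" if "\<not> k < n" "k < n + m" for k
    proof -
      have "skip j (k - n) \<le> m"
        using that by (auto simp: skip_def)
      then show ?thesis
        using st assms by simp
    qed
    ultimately show ?thesis
      by (auto simp: proj_coords_def fun_eq_iff)
  qed
  moreover have "x \<in> proj_class n m x"
    using equiv_class_self[OF equiv_proj_rel assms(1)] by (simp add: proj_class_def)
  ultimately have "proj_coords n m i j ` proj_class n m x = {proj_coords n m i j x}"
    unfolding proj_class_def by blast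
  then show ?thesis
    by (simp add: proj_chart_def)
qed

end

theory Submission
  imports Defs
begin

text \<open>
  The class of a point \<open>x\<close> with pivots \<open>i\<close> and \<open>j\<close>, i.e. with \<open>x i\<close> invertible and
  \<open>ze (x (n + 1 + j)) \<noteq> 0\<close>, has exactly one representative whose two pivots are \<open>1\<close> and
  \<^const>\<open>zd_unit\<close>.  Forgetting these two entries is the chart; putting them back is
  \<open>affine_lift\<close>.  So each chart is a bijection from its domain onto the whole coordinate space, with
  inverse \<open>z \<mapsto> [affine_lift z]\<close>.  A chart overlap is the locus where one dual and one real entry of
  the lift are both nonzero, which is open because the entries are coordinates or constants, and a
  transition map divides lift entries by these two.

  In terms of real and zero-divisor parts, such quotients are rational functions with denominators
  that do not vanish on the overlap.  The partial derivatives of a rational function are again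
  rational, with denominators vanishing nowhere new, so one induction on the order of
  differentiability gives smoothness (\<open>rational_on_derivative\<close>, \<open>rational_on_Ck\<close>).

  For the Hausdorff property it is enough to separate points of the quotient by continuous real
  functions, i.e. to separate classes by continuous invariants.  As real projective space embeds into
  the symmetric matrices by \<open>[x] \<mapsto> (x\<^sub>i x\<^sub>k / |x|\<^sup>2)\<close>, the same formula, read over the dual numbers in
  the first block and over the reals in the second, gives such invariants: the real part of
  \<open>\<Sum>l\<le>n. x l * x l\<close> is a sum of squares, hence the sum is invertible as soon as one \<open>x l\<close> is.
\<close>

section \<open>Arithmetic of dual numbers\<close>

lemma dual_sel_simps [simp]:
  fixes x y :: dual
  shows "re 0 = 0" "ze 0 = 0" "re 1 = 1" "ze 1 = 0" "re zd_unit = 0" "ze zd_unit = 1"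
    "re (x + y) = re x + re y" "ze (x + y) = ze x + ze y"
    "re (- x) = - re x" "ze (- x) = - ze x"
    "re (x - y) = re x - re y" "ze (x - y) = ze x - ze y"
    "re (x * y) = re x * re y" "ze (x * y) = re x * ze y + ze x * re y"
    "re (c *\<^sub>R x) = c * re x" "ze (c *\<^sub>R x) = c * ze x"
    "re (inverse x) = inverse (re x)" "ze (inverse x) = - (ze x * (inverse (re x) * inverse (re x)))"
  by (simp_all add: zero_dual_def one_dual_def zd_unit_def plus_dual_def minus_dual_def
      uminus_dual_def times_dual_def scaleR_dual_def inverse_dual_def divide_inverse power2_eq_square)

lemma re_sum_dual: "re (sum f A) = (\<Sum>a\<in>A. re (f a))"
  by (induction A rule: infinite_finite_induct) simp_all

section \<open>Topology of the coordinate space\<close>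

lemma zd_coord_le_dist:
  shows "k < n \<Longrightarrow> \<bar>re (x k) - re (y k)\<bar> \<le> zd_dist n m x y"
    and "k < n + m \<Longrightarrow> \<bar>ze (x k) - ze (y k)\<bar> \<le> zd_dist n m x y"
proof -
  let ?I = "{..<n} <+> {..<n + m}"
  let ?D = "\<lambda>i. case i of Inl k \<Rightarrow> sqrt 2 * (re (x k) - re (y k)) | Inr k \<Rightarrow> ze (x k) - ze (y k)"
  have D: "\<bar>?D i\<bar> \<le> zd_dist n m x y" if "i \<in> ?I" for i
    unfolding zd_dist_L2_set L2_set_def
    by (intro real_le_rsqrt) (use that in \<open>auto intro!: member_le_sum\<close>)
  {
    assume "k < n"
    have "\<bar>re (x k) - re (y k)\<bar> \<le> sqrt 2 * \<bar>re (x k) - re (y k)\<bar>"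
      by (simp add: mult_le_cancel_right1)
    also have "\<dots> \<le> zd_dist n m x y"
      using D[of "Inl k"] \<open>k < n\<close> by (auto simp: abs_mult)
    finally show "\<bar>re (x k) - re (y k)\<bar> \<le> zd_dist n m x y" .
  }
  assume "k < n + m"
  then show "\<bar>ze (x k) - ze (y k)\<bar> \<le> zd_dist n m x y"
    using D[of "Inr k"] by auto
qed

lemma continuous_map_zd_Lipschitz:
  assumes "\<And>x y. x \<in> zd_space n m \<Longrightarrow> y \<in> zd_space n m \<Longrightarrow> \<bar>f x - f y\<bar> \<le> zd_dist n m x y"
  shows "continuous_map (zd_topology n m) euclideanreal f"
proof -
  interpret Metric_space "zd_space n m" "zd_dist n m"
    by (rule Metric_space_zd)
  show ?thesis
    unfolding zd_topology_def continuous_map_def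
  proof (intro conjI ballI allI impI)
    fix V :: "real set" assume "openin euclideanreal V"
    then have V: "open V" by simp
    show "openin mtopology {x \<in> topspace mtopology. f x \<in> V}"
      unfolding openin_mtopology
    proof (intro conjI allI impI)
      fix x assume x: "x \<in> {x \<in> topspace mtopology. f x \<in> V}"
      then obtain r where r: "r > 0" "ball (f x) r \<subseteq> V"
        using V openE by blast
      have "mball x r \<subseteq> {x \<in> topspace mtopology. f x \<in> V}"
        using assms[of x] r by (fastforce simp: dist_real_def subset_iff)
      then show "\<exists>r>0. mball x r \<subseteq> {x \<in> topspace mtopology. f x \<in> V}"
        using r by blast
    qed auto
  qed auto
qed

lemma continuous_map_zd_coord:
  "continuous_map (zd_topology n m) euclideanreal (\<lambda>x. re (x k))"
  "continuous_map (zd_topology n m) euclideanreal (\<lambda>x. ze (x k))"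
proof -
  interpret Metric_space "zd_space n m" "zd_dist n m"
    by (rule Metric_space_zd)
  have "\<bar>re (x k) - re (y k)\<bar> \<le> zd_dist n m x y \<and> \<bar>ze (x k) - ze (y k)\<bar> \<le> zd_dist n m x y"
    if "x \<in> zd_space n m" "y \<in> zd_space n m" for x y
    using that zd_coord_le_dist(1)[of k n x y m] zd_coord_le_dist(2)[of k n m x y] by (cases "k < n"; cases "k < n + m") (auto simp: zd_space_def)
  then show "continuous_map (zd_topology n m) euclideanreal (\<lambda>x. re (x k))"
    "continuous_map (zd_topology n m) euclideanreal (\<lambda>x. ze (x k))"
    by (auto intro!: continuous_map_zd_Lipschitz)
qed

text \<open>
  Partial derivatives at \<open>x\<close> therefore depend only on the values near \<open>x\<close> within an open set, even though
  the functions are defined on all tuples.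
\<close>

lemma eventually_zd_line:
  assumes S: "openin (zd_topology n m) S" and x: "x \<in> S" and e: "e \<in> zd_dirs n m"
  shows "\<forall>\<^sub>F h in nhds 0. zd_line x e h \<in> S"
proof -
  interpret Metric_space "zd_space n m" "zd_dist n m"
    by (rule Metric_space_zd)
  obtain r where r: "r > 0" "mball x r \<subseteq> S" and "S \<subseteq> zd_space n m"
    using S x unfolding zd_topology_def openin_mtopology by blast
  then have xs: "x \<in> zd_space n m"
    using x by blast
  have line: "zd_line x e h \<in> zd_space n m" for h
    using xs e by (auto simp: zd_space_def zd_line_def zd_dirs_def dual_eq_iff split: if_splits)
  have "zd_dist n m x (zd_line x e h) = \<bar>h\<bar> * zd_norm n m e" for h
  proof -
    have "zd_inner n m (\<lambda>k. x k - zd_line x e h k) (\<lambda>k. x k - zd_line x e h k)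
       = h\<^sup>2 * zd_inner n m e e"
      by (simp add: zd_inner_def zd_line_def sum_distrib_left power2_eq_square algebra_simps)
    then show ?thesis
      by (simp add: zd_dist_def zd_norm_def real_sqrt_mult)
  qed
  moreover have "((\<lambda>h. \<bar>h\<bar> * zd_norm n m e) \<longlongrightarrow> \<bar>0\<bar> * zd_norm n m e) (nhds 0)"
    by (intro tendsto_intros filterlim_ident)
  then have "\<forall>\<^sub>F h in nhds 0. \<bar>h\<bar> * zd_norm n m e < r"
    using r by (intro order_tendstoD) auto
  ultimately show ?thesis
    using r line xs by (auto elim!: eventually_mono)
qed

section \<open>Rational functions are smooth\<close>

text \<open>
  The side condition for inverses is imposed on all of \<open>S\<close>, so that membership yields continuity and
  differentiability on \<open>S\<close>.
\<close>

inductive rational_on :: "tuple set \<Rightarrow> (tuple \<Rightarrow> real) \<Rightarrow> bool" for S where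
  const: "rational_on S (\<lambda>_. c)"
| re_coord: "rational_on S (\<lambda>x. re (x k))"
| ze_coord: "rational_on S (\<lambda>x. ze (x k))"
| add: "rational_on S f \<Longrightarrow> rational_on S g \<Longrightarrow> rational_on S (\<lambda>x. f x + g x)"
| mult: "rational_on S f \<Longrightarrow> rational_on S g \<Longrightarrow> rational_on S (\<lambda>x. f x * g x)"
| inverse: "rational_on S f \<Longrightarrow> (\<And>x. x \<in> S \<Longrightarrow> f x \<noteq> 0) \<Longrightarrow> rational_on S (\<lambda>x. inverse (f x))"

lemma rational_on_uminus: "rational_on S f \<Longrightarrow> rational_on S (\<lambda>x. - f x)"
  using rational_on.mult[OF rational_on.const[of S "-1"]] by fastforce

lemma rational_on_continuous:
  assumes "rational_on S f"
  shows "continuous_map (subtopology (zd_topology n m) S) euclideanreal f"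
  using assms
proof induction
  case (inverse f)
  then show ?case
    by (intro continuous_map_real_inverse) auto
qed (auto intro: continuous_map_add continuous_map_real_mult
    continuous_map_from_subtopology continuous_map_zd_coord)

text \<open>
  Closure under partial derivatives: by the quotient rule, differentiation only produces powers of
  denominators that are already nonzero on \<open>S\<close>.
\<close>

lemma rational_on_derivative:
  assumes "rational_on S f"
  shows "\<exists>g. rational_on S g \<and>
    (\<forall>x\<in>S. ((\<lambda>h. f (zd_line x e h)) has_real_derivative g x) (at 0))"
  using assms
proof induction
  case (const c)
  show ?case
    by (intro exI[of _ "\<lambda>_. 0"]) (auto intro: rational_on.const)
next
  case (re_coord k)
  show ?case
    by (intro exI[of _ "\<lambda>_. re (e k)"])
      (auto intro: rational_on.const simp: zd_line_def intro!: derivative_eq_intros)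
next
  case (ze_coord k)
  show ?case
    by (intro exI[of _ "\<lambda>_. ze (e k)"])
      (auto intro: rational_on.const simp: zd_line_def intro!: derivative_eq_intros)
next
  case (add f g)
  then obtain f' g' where "rational_on S f'" "rational_on S g'"
    "\<forall>x\<in>S. ((\<lambda>h. f (zd_line x e h)) has_real_derivative f' x) (at 0)"
    "\<forall>x\<in>S. ((\<lambda>h. g (zd_line x e h)) has_real_derivative g' x) (at 0)"
    by blast
  then show ?case
    by (intro exI[of _ "\<lambda>x. f' x + g' x"]) (auto intro: rational_on.add DERIV_add)
next
  case (mult f g)
  then obtain f' g' where *: "rational_on S f'" "rational_on S g'"
    "\<forall>x\<in>S. ((\<lambda>h. f (zd_line x e h)) has_real_derivative f' x) (at 0)"
    "\<forall>x\<in>S. ((\<lambda>h. g (zd_line x e h)) has_real_derivative g' x) (at 0)"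
    by blast
  have "rational_on S (\<lambda>x. f' x * g x + g' x * f x)"
    using * mult.hyps by (intro rational_on.add rational_on.mult)
  moreover have "((\<lambda>h. f (zd_line x e h) * g (zd_line x e h)) has_real_derivative
      f' x * g x + g' x * f x) (at 0)" if "x \<in> S" for x
    using DERIV_mult[OF *(3)[rule_format, OF that] *(4)[rule_format, OF that]]
    by (simp add: zd_line_def)
  ultimately show ?case
    by (intro exI[of _ "\<lambda>x. f' x * g x + g' x * f x"]) auto
next
  case (inverse f)
  then obtain f' where *: "rational_on S f'"
    "\<forall>x\<in>S. ((\<lambda>h. f (zd_line x e h)) has_real_derivative f' x) (at 0)"
    by blast
  have "rational_on S (\<lambda>x. - (inverse (f x) * f' x * inverse (f x)))"
    using * inverse.hyps
    by (intro rational_on_uminus rational_on.mult rational_on.inverse)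
  moreover have "((\<lambda>h. inverse (f (zd_line x e h))) has_real_derivative
      - (inverse (f x) * f' x * inverse (f x))) (at 0)" if "x \<in> S" for x
    using DERIV_inverse'[OF *(2)[rule_format, OF that]] inverse.hyps(2)[OF that]
    by (simp add: zd_line_def)
  ultimately show ?case
    by (intro exI[of _ "\<lambda>x. - (inverse (f x) * f' x * inverse (f x))"]) auto
qed

text \<open>
  Chart transitions and iterated partial derivatives agree with explicit rational expressions only on
  the open set in question; this transports smoothness across such agreement.
\<close>

lemma Ck_on_cong:
  assumes "openin (zd_topology n m) S" "Ck_on n m r S f" "\<And>x. x \<in> S \<Longrightarrow> f x = g x"
  shows "Ck_on n m r S g"
  using assms(2,3)
proof (induction r arbitrary: f g)
  case 0
  then show ?case
    by (auto elim!: continuous_map_eq)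
next
  case (Suc r)
  have near: "\<forall>\<^sub>F h in nhds 0. f (zd_line x e h) = g (zd_line x e h)"
    if "x \<in> S" "e \<in> zd_dirs n m" for x e
    using eventually_zd_line[OF assms(1) that] by eventually_elim (rule Suc.prems)
  have "continuous_map (subtopology (zd_topology n m) S) euclideanreal g"
    using Suc.prems by (auto elim!: continuous_map_eq)
  moreover have "(\<lambda>h. g (zd_line x e h)) differentiable at 0"
    if "x \<in> S" "e \<in> zd_dirs n m" for x e
  proof -
    have "(\<lambda>h. f (zd_line x e h)) differentiable at 0"
      using Suc.prems(1) that by simp
    then obtain D where "DERIV (\<lambda>h. f (zd_line x e h)) 0 :> D"
      by (auto simp: real_differentiable_def)
    then have "DERIV (\<lambda>h. g (zd_line x e h)) 0 :> D"
      using DERIV_cong_ev[OF refl near[OF that] refl] by blast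
    then show ?thesis
      by (auto simp: real_differentiable_def)
  qed
  moreover have "Ck_on n m r S (partial_deriv e g)" if e: "e \<in> zd_dirs n m" for e
  proof (rule Suc.IH)
    show "Ck_on n m r S (partial_deriv e f)"
      using Suc.prems(1) e by simp
    show "partial_deriv e f x = partial_deriv e g x" if "x \<in> S" for x
      unfolding partial_deriv_def by (rule deriv_cong_ev[OF near[OF that e] refl])
  qed
  ultimately show ?case
    by simp
qed

lemma rational_on_Ck:
  assumes "openin (zd_topology n m) S" "rational_on S f"
  shows "Ck_on n m r S f"
  using assms(2)
proof (induction r arbitrary: f)
  case 0
  then show ?case
    by (simp add: rational_on_continuous)
next
  case (Suc r)
  have "(\<forall>x\<in>S. (\<lambda>h. f (zd_line x e h)) differentiable at 0) \<and> Ck_on n m r S (partial_deriv e f)" for e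
  proof -
    obtain g where g: "rational_on S g"
      "\<And>x. x \<in> S \<Longrightarrow> ((\<lambda>h. f (zd_line x e h)) has_real_derivative g x) (at 0)"
      using rational_on_derivative[OF Suc.prems] by blast
    have "Ck_on n m r S (partial_deriv e f)"
      by (rule Ck_on_cong[OF assms(1) Suc.IH[OF g(1)]])
        (simp add: partial_deriv_def DERIV_imp_deriv[OF g(2)])
    then show ?thesis
      using g(2) by (auto simp: real_differentiable_def)
  qed
  then show ?case
    using Suc.prems by (simp add: rational_on_continuous)
qed

definition dual_rational_on :: "tuple set \<Rightarrow> (tuple \<Rightarrow> dual) \<Rightarrow> bool" where
  "dual_rational_on S f \<longleftrightarrow> rational_on S (\<lambda>x. re (f x)) \<and> rational_on S (\<lambda>x. ze (f x))"

lemma dual_rational_onI: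
  "dual_rational_on S (\<lambda>_. c)"
  "dual_rational_on S (\<lambda>x. x k)"
  "dual_rational_on S f \<Longrightarrow> dual_rational_on S g \<Longrightarrow> dual_rational_on S (\<lambda>x. f x + g x)"
  "dual_rational_on S f \<Longrightarrow> dual_rational_on S g \<Longrightarrow> dual_rational_on S (\<lambda>x. f x * g x)"
  "dual_rational_on S f \<Longrightarrow> (\<And>x. x \<in> S \<Longrightarrow> re (f x) \<noteq> 0) \<Longrightarrow> dual_rational_on S (\<lambda>x. inverse (f x))"
  "rational_on S h \<Longrightarrow> dual_rational_on S f \<Longrightarrow> dual_rational_on S (\<lambda>x. h x *\<^sub>R f x)"
  by (auto simp: dual_rational_on_def intro!: rational_on.intros rational_on_uminus)

lemma dual_rational_on_sum:
  "(\<And>a. a \<in> A \<Longrightarrow> dual_rational_on S (f a)) \<Longrightarrow> dual_rational_on S (\<lambda>x. \<Sum>a\<in>A. f a x)"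
  by (induction A rule: infinite_finite_induct) (simp_all add: dual_rational_onI)

lemma rational_on_sum:
  "(\<And>a. a \<in> A \<Longrightarrow> rational_on S (f a)) \<Longrightarrow> rational_on S (\<lambda>x. \<Sum>a\<in>A. f a x)"
  by (induction A rule: infinite_finite_induct) (simp_all add: rational_on.intros)

lemma dual_rational_on_smooth:
  assumes "openin (zd_topology n m) S" "dual_rational_on S f" "\<And>x. x \<in> S \<Longrightarrow> f x = g x"
  shows "dual_smooth_on n m S g"
proof -
  have "Ck_on n m r S (\<lambda>x. re (g x))" "Ck_on n m r S (\<lambda>x. ze (g x))" for r
    using assms(2,3) unfolding dual_rational_on_def
    by (auto intro: Ck_on_cong[OF assms(1) rational_on_Ck[OF assms(1)]])
  then show ?thesis
    using assms(1) by (simp add: dual_smooth_on_def real_smooth_on_def)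
qed

section \<open>Affine lifts\<close>

definition unskip :: "nat \<Rightarrow> nat \<Rightarrow> nat" where
  "unskip i k = (if k < i then k else k - 1)"

lemma skip_unskip: "k \<noteq> i \<Longrightarrow> skip i (unskip i k) = k"
  by (auto simp: skip_def unskip_def)

lemma unskip_skip [simp]: "unskip i (skip i k) = k"
  by (auto simp: skip_def unskip_def)

lemma skip_neq [simp]: "skip i k \<noteq> i"
  by (auto simp: skip_def)

lemma skip_less: "k < n \<Longrightarrow> skip i k \<le> n"
  by (auto simp: skip_def)

lemma unskip_less: "k \<le> n \<Longrightarrow> k \<noteq> i \<Longrightarrow> i \<le> n \<Longrightarrow> unskip i k < n"
  by (auto simp: unskip_def)

text \<open>
  The representative, in homogeneous coordinates, of the point with affine coordinates \<open>z\<close> in the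
  chart with pivots \<open>i\<close> and \<open>j\<close>.
\<close>

definition affine_lift :: "nat \<Rightarrow> nat \<Rightarrow> nat \<Rightarrow> nat \<Rightarrow> tuple \<Rightarrow> tuple" where
  "affine_lift n m i j z =
     (\<lambda>k. if k \<le> n then (if k = i then 1 else z (unskip i k))
          else if k \<le> n + m + 1
          then (if k = n + 1 + j then zd_unit else z (n + unskip j (k - (n + 1))))
          else 0)"

lemma affine_lift_pivot [simp]:
  "i \<le> n \<Longrightarrow> affine_lift n m i j z i = 1"
  "j \<le> m \<Longrightarrow> affine_lift n m i j z (n + 1 + j) = zd_unit"
  "j \<le> m \<Longrightarrow> affine_lift n m i j z (Suc (n + j)) = zd_unit"
  by (simp_all add: affine_lift_def)

lemma affine_lift_punctured:
  assumes "z \<in> zd_space n m" "i \<le> n" "j \<le> m"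
  shows "affine_lift n m i j z \<in> zd_punctured n m"
proof -
  have "affine_lift n m i j z \<in> zd_space (n + 1) (m + 1)"
    using assms unskip_less[of _ m j] by (auto simp: zd_space_def affine_lift_def)
  moreover have "affine_lift n m i j z \<notin> zd_V n m"
    using assms by (auto simp: zd_V_def intro!: exI[of _ i])
  moreover have "affine_lift n m i j z \<notin> zd_W n m"
    using assms by (auto simp: zd_W_def intro!: exI[of _ j])
  ultimately show ?thesis
    by (simp add: zd_punctured_def)
qed

lemma proj_coords_in_zd_space: "proj_coords n m i j x \<in> zd_space n m"
  by (auto simp: zd_space_def proj_coords_def)

lemma dual_divide_1 [simp]: "x / 1 = (x :: dual)"
  by (simp add: divide_dual_def dual_eq_iff)

lemma proj_coords_affine_lift:
  assumes "z \<in> zd_space n m" "i \<le> n" "j \<le> m"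
  shows "proj_coords n m i j (affine_lift n m i j z) = z"
proof
  fix k
  have "ze (z k) *\<^sub>R zd_unit = z k" if "n \<le> k" "k < n + m"
    using assms that by (auto simp: zd_space_def dual_eq_iff)
  moreover have "affine_lift n m i j z (skip i k) = z k" if "k < n"
    using that skip_less[of k n i] by (simp add: affine_lift_def)
  moreover have "affine_lift n m i j z (Suc (n + skip j (k - n))) = z k" if "n \<le> k" "k < n + m"
    using that skip_less[of "k - n" m j] by (simp add: affine_lift_def)
  ultimately show "proj_coords n m i j (affine_lift n m i j z) k = z k"
    using assms by (auto simp: proj_coords_def zd_space_def)
qed

text \<open>
  Scaling the first block by \<open>inverse (x i)\<close> and the second by \<open>inverse (ze (x (n + 1 + j)))\<close>
  normalises both pivots.
\<close>

lemma affine_lift_proj_coords_rel: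
  assumes x: "x \<in> zd_punctured n m" and ij: "i \<le> n" "j \<le> m"
    and nz: "re (x i) \<noteq> 0" "ze (x (n + 1 + j)) \<noteq> 0"
  shows "(x, affine_lift n m i j (proj_coords n m i j x)) \<in> proj_rel n m"
proof -
  let ?y = "affine_lift n m i j (proj_coords n m i j x)"
  have "?y k = inverse (x i) * x k" if "k \<le> n" for k
    using that ij nz inverse_dual[of "x i"] unskip_less[of k n i]
    by (simp add: affine_lift_def proj_coords_def skip_unskip divide_dual_def mult.commute)
  moreover have "ze (?y (n + 1 + l)) = inverse (ze (x (n + 1 + j))) * ze (x (n + 1 + l))"
    if "l \<le> m" for l
    using that ij nz unskip_less[of l m j]
    by (simp add: affine_lift_def proj_coords_def skip_unskip divide_inverse mult.commute)
  moreover have "re (inverse (x i)) \<noteq> 0" "inverse (ze (x (n + 1 + j))) \<noteq> 0"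
    using nz by auto
  ultimately show ?thesis
    unfolding proj_rel_def
    using x affine_lift_punctured[OF proj_coords_in_zd_space ij] by blast
qed

lemma dual_rational_on_affine_lift: "dual_rational_on S (\<lambda>z. affine_lift n m i j z k)"
  unfolding affine_lift_def
  by (cases "k \<le> n"; cases "k = i"; cases "k \<le> n + m + 1"; cases "k = n + 1 + j")
    (simp_all add: dual_rational_onI)

section \<open>The standard charts\<close>

lemma proj_class_eq_iff:
  assumes "x \<in> zd_punctured n m" "y \<in> zd_punctured n m"
  shows "proj_class n m x = proj_class n m y \<longleftrightarrow> (x, y) \<in> proj_rel n m"
  unfolding proj_class_def using eq_equiv_class_iff[OF equiv_proj_rel assms] .

lemma proj_class_in_U_iff:
  assumes "x \<in> zd_punctured n m" "i \<le> n" "j \<le> m"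
  shows "proj_class n m x \<in> proj_U n m i j \<longleftrightarrow> re (x i) \<noteq> 0 \<and> ze (x (n + 1 + j)) \<noteq> 0"
proof
  assume "proj_class n m x \<in> proj_U n m i j"
  then obtain y where y: "y \<in> zd_punctured n m" "re (y i) \<noteq> 0" "ze (y (n + 1 + j)) \<noteq> 0"
    "proj_class n m x = proj_class n m y"
    by (auto simp: proj_U_def)
  then have "(x, y) \<in> proj_rel n m"
    using proj_class_eq_iff assms by blast
  then show "re (x i) \<noteq> 0 \<and> ze (x (n + 1 + j)) \<noteq> 0"
    using y assms by (auto simp: proj_rel_def)
qed (use assms in \<open>auto simp: proj_U_def\<close>)

lemma proj_chart_lift:
  assumes "z \<in> zd_space n m" "i \<le> n" "j \<le> m"
  shows "proj_class n m (affine_lift n m i j z) \<in> proj_U n m i j"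
    and "proj_chart n m i j (proj_class n m (affine_lift n m i j z)) = z"
  using assms affine_lift_punctured[OF assms]
  by (simp_all add: proj_class_in_U_iff proj_chart_class proj_coords_affine_lift)

lemma proj_lift_chart:
  assumes "c \<in> proj_U n m i j" "i \<le> n" "j \<le> m"
  shows "proj_chart n m i j c \<in> zd_space n m"
    and "proj_class n m (affine_lift n m i j (proj_chart n m i j c)) = c"
proof -
  obtain x where x: "x \<in> zd_punctured n m" "re (x i) \<noteq> 0" "ze (x (n + 1 + j)) \<noteq> 0"
    and c: "c = proj_class n m x"
    using assms by (auto simp: proj_U_def)
  then have chart: "proj_chart n m i j c = proj_coords n m i j x"
    using assms proj_chart_class by blast
  then show "proj_chart n m i j c \<in> zd_space n m"
    by (simp add: proj_coords_in_zd_space)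
  show "proj_class n m (affine_lift n m i j (proj_chart n m i j c)) = c"
    unfolding chart unfolding c
    using affine_lift_proj_coords_rel[OF x(1) assms(2,3) x(2,3)] x(1) assms
    by (metis proj_class_eq_iff affine_lift_punctured proj_coords_in_zd_space)
qed

lemma inj_on_proj_chart:
  assumes "i \<le> n" "j \<le> m"
  shows "inj_on (proj_chart n m i j) (proj_U n m i j)"
  by (rule inj_onI) (metis proj_lift_chart(2) assms)

text \<open>
  The point with coordinates \<open>z\<close> is the class of its lift, so it lies in the second domain exactly
  when the pivots of the second chart are nonzero in the lift.
\<close>

lemma proj_chart_overlap:
  assumes "i \<le> n" "j \<le> m" "i' \<le> n" "j' \<le> m"
  shows "proj_chart n m i j ` (proj_U n m i j \<inter> proj_U n m i' j') =
    {z \<in> zd_space n m. re (affine_lift n m i j z i') \<noteq> 0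
       \<and> ze (affine_lift n m i j z (n + 1 + j')) \<noteq> 0}" (is "?L = ?R")
proof
  show "?L \<subseteq> ?R"
  proof
    fix z assume "z \<in> ?L"
    then obtain c where c: "c \<in> proj_U n m i j" "c \<in> proj_U n m i' j'" "z = proj_chart n m i j c"
      by blast
    then have z: "z \<in> zd_space n m" "proj_class n m (affine_lift n m i j z) = c"
      using proj_lift_chart assms by blast+
    then show "z \<in> ?R"
      using c(2) proj_class_in_U_iff[OF affine_lift_punctured[OF z(1) assms(1,2)] assms(3,4)] by simp
  qed
  show "?R \<subseteq> ?L"
  proof
    fix z assume z: "z \<in> ?R"
    then have "proj_class n m (affine_lift n m i j z) \<in> proj_U n m i j \<inter> proj_U n m i' j'"
      using assms by (simp add: proj_class_in_U_iff affine_lift_punctured)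
    then show "z \<in> ?L"
      using z proj_chart_lift(2)[of z n m i j] assms by (metis (no_types, lifting) imageI mem_Collect_eq)
  qed
qed

lemma openin_nonzero_locus:
  assumes "continuous_map X euclideanreal f" "continuous_map X euclideanreal g"
  shows "openin X {x \<in> topspace X. f x \<noteq> 0 \<and> g x \<noteq> 0}"
proof -
  have "openin X {x \<in> topspace X. f x * g x \<in> - {0}}"
    by (intro openin_continuous_map_preimage[of _ euclideanreal] continuous_map_real_mult assms) auto
  then show ?thesis
    by simp
qed

lemma openin_proj_chart_overlap:
  assumes "i \<le> n" "j \<le> m" "i' \<le> n" "j' \<le> m"
  shows "openin (zd_topology n m) (proj_chart n m i j ` (proj_U n m i j \<inter> proj_U n m i' j'))"
proof -
  have "rational_on UNIV (\<lambda>z. re (affine_lift n m i j z i'))"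
    "rational_on UNIV (\<lambda>z. ze (affine_lift n m i j z (n + 1 + j')))"
    using dual_rational_on_affine_lift by (auto simp only: dual_rational_on_def)
  then have "continuous_map (zd_topology n m) euclideanreal (\<lambda>z. re (affine_lift n m i j z i'))"
    "continuous_map (zd_topology n m) euclideanreal (\<lambda>z. ze (affine_lift n m i j z (n + 1 + j')))"
    using rational_on_continuous[of UNIV _ n m] by (simp_all only: subtopology_UNIV)
  then show ?thesis
    using openin_nonzero_locus unfolding proj_chart_overlap[OF assms] topspace_zd[symmetric] by blast
qed

text \<open>
  Composing through the lift, each component is an entry of the lift divided by a second pivot, and
  these pivots are nonzero on the overlap.
\<close>

lemma smooth_proj_transition:
  assumes "i \<le> n" "j \<le> m" "i' \<le> n" "j' \<le> m"
  shows "zd_smooth_on n m n m (proj_chart n m i j ` (proj_U n m i j \<inter> proj_U n m i' j'))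
    (proj_chart n m i' j' \<circ> the_inv_into (proj_U n m i j) (proj_chart n m i j))"
    (is "zd_smooth_on _ _ _ _ ?S ?T")
proof -
  let ?F = "\<lambda>z. proj_coords n m i' j' (affine_lift n m i j z)"
  have T: "?T z = ?F z" if "z \<in> ?S" for z
  proof -
    have z: "z \<in> zd_space n m" "re (affine_lift n m i j z i') \<noteq> 0"
      "ze (affine_lift n m i j z (n + 1 + j')) \<noteq> 0"
      using that unfolding proj_chart_overlap[OF assms] by auto
    have "the_inv_into (proj_U n m i j) (proj_chart n m i j) z = proj_class n m (affine_lift n m i j z)"
      using proj_chart_lift[OF z(1) assms(1,2)] inj_on_proj_chart[OF assms(1,2)]
      by (metis the_inv_into_f_eq)
    then show ?thesis
      using z assms by (simp add: proj_chart_class affine_lift_punctured)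
  qed
  have "dual_rational_on ?S (\<lambda>z. ?F z k)" for k
  proof -
    have pivot: "re (affine_lift n m i j z i') \<noteq> 0" "ze (affine_lift n m i j z (n + 1 + j')) \<noteq> 0"
      if "z \<in> ?S" for z
      using that unfolding proj_chart_overlap[OF assms] by auto
    have ze: "rational_on ?S (\<lambda>z. ze (affine_lift n m i j z l))" for l
      using dual_rational_on_affine_lift by (auto simp only: dual_rational_on_def)
    consider "k < n" | "n \<le> k" "k < n + m" | "n + m \<le> k"
      by linarith
    then show ?thesis
    proof cases
      case 1
      then show ?thesis
        unfolding proj_coords_def divide_dual_def
        using pivot(1) by (auto intro!: dual_rational_onI(4,5) dual_rational_on_affine_lift)
    next
      case 2
      then show ?thesis
        unfolding proj_coords_def divide_inverse
        using pivot(2)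
        by (auto intro!: dual_rational_onI(6) dual_rational_onI(1) rational_on.mult
            rational_on.inverse ze simp del: add_Suc_right)
    next
      case 3
      then show ?thesis
        by (simp add: proj_coords_def dual_rational_onI(1))
    qed
  qed
  then have "dual_smooth_on n m ?S (\<lambda>z. ?T z k)" for k
    by (rule dual_rational_on_smooth[OF openin_proj_chart_overlap[OF assms]]) (simp only: T)
  moreover have "?T ` ?S \<subseteq> zd_space n m"
    using T proj_coords_in_zd_space by auto
  ultimately show ?thesis
    unfolding zd_smooth_on_def by blast
qed

lemma topspace_proj_cover:
  "topspace (proj_module n m) = (\<Union>i\<le>n. \<Union>j\<le>m. proj_U n m i j)"
proof
  show "topspace (proj_module n m) \<subseteq> (\<Union>i\<le>n. \<Union>j\<le>m. proj_U n m i j)"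
  proof
    fix c assume "c \<in> topspace (proj_module n m)"
    then obtain x where x: "x \<in> zd_punctured n m" "c = proj_class n m x"
      by (auto simp: topspace_proj_module proj_class_def elim: quotientE)
    then obtain i j where "i \<le> n" "re (x i) \<noteq> 0" "j \<le> m" "ze (x (n + 1 + j)) \<noteq> 0"
      by (auto simp: zd_punctured_def zd_V_def zd_W_def)
    then show "c \<in> (\<Union>i\<le>n. \<Union>j\<le>m. proj_U n m i j)"
      using x by (auto simp: proj_U_def)
  qed
  show "(\<Union>i\<le>n. \<Union>j\<le>m. proj_U n m i j) \<subseteq> topspace (proj_module n m)"
    by (auto simp: proj_U_def topspace_proj_module proj_class_def intro: quotientI)
qed

lemma topspace_punctured:
  "topspace (subtopology (zd_topology (n + 1) (m + 1)) (zd_punctured n m)) = zd_punctured n m"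
  by (auto simp: zd_punctured_def)

text \<open>
  Nonvanishing of a pivot does not depend on the representative, so the preimage in the punctured
  module is the open locus where both pivots are nonzero.
\<close>

lemma openin_proj_U:
  assumes "i \<le> n" "j \<le> m"
  shows "openin (proj_module n m) (proj_U n m i j)"
proof -
  let ?X = "subtopology (zd_topology (n + 1) (m + 1)) (zd_punctured n m)"
  have "{x \<in> topspace ?X. proj_rel n m `` {x} \<in> proj_U n m i j} =
      {x \<in> topspace ?X. re (x i) \<noteq> 0 \<and> ze (x (n + 1 + j)) \<noteq> 0}"
    unfolding topspace_punctured proj_class_def[symmetric]
    by (intro Collect_cong conj_cong refl proj_class_in_U_iff assms)
  moreover have "openin ?X \<dots>"
    by (intro openin_nonzero_locus continuous_map_from_subtopology continuous_map_zd_coord)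
  moreover have "proj_U n m i j \<subseteq> topspace ?X // proj_rel n m"
    unfolding topspace_punctured by (auto simp: proj_U_def proj_class_def intro: quotientI)
  ultimately show ?thesis
    by (simp only: proj_module_def openin_quotient_topology)
qed

lemma proj_atlas:
  "zd_smooth_atlas n m (proj_module n m)
     {(proj_U n m i j, proj_chart n m i j) | i j. i \<le> n \<and> j \<le> m}" (is "zd_smooth_atlas _ _ _ ?A")
proof -
  let ?C = "\<lambda>(i, j). (proj_U n m i j, proj_chart n m i j)"
  let ?I = "{..n} \<times> {..m}"
  have A: "?A = ?C ` ?I"
    unfolding image_def by (rule Collect_cong, simp) blast
  have image: "openin (zd_topology n m) (proj_chart n m i j ` proj_U n m i j)"
    if "i \<le> n" "j \<le> m" for i j
    using openin_proj_chart_overlap[OF that that] by simp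
  have overlap: "openin (zd_topology n m) (proj_chart n m i' j' ` (proj_U n m i j \<inter> proj_U n m i' j'))"
    if "i \<le> n" "j \<le> m" "i' \<le> n" "j' \<le> m" for i j i' j'
    using openin_proj_chart_overlap[OF that(3,4,1,2)] by (simp only: Int_commute)
  show ?thesis
    unfolding zd_smooth_atlas_def A
  proof (intro conjI)
    show "countable (?C ` ?I)"
      by (intro countable_finite finite_imageI finite_SigmaI) simp_all
    show "topspace (proj_module n m) = (\<Union>(U, \<Phi>)\<in>?C ` ?I. U)"
      unfolding topspace_proj_cover by (auto simp del: o_apply)
  qed (simp_all add: openin_proj_U image inj_on_proj_chart openin_proj_chart_overlap overlap
      smooth_proj_transition)
qed

section \<open>The Hausdorff property\<close>

text \<open>
  An invariant function descends to the quotient, where preimages of disjoint neighbourhoods of two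
  of its values separate points.
\<close>

lemma Hausdorff_space_quotient_map:
  assumes q: "quotient_map X Y q"
    and sep: "\<And>x y. x \<in> topspace X \<Longrightarrow> y \<in> topspace X \<Longrightarrow> q x \<noteq> q y \<Longrightarrow>
      \<exists>h. continuous_map X euclideanreal h \<and>
        (\<forall>u\<in>topspace X. \<forall>v\<in>topspace X. q u = q v \<longrightarrow> h u = h v) \<and> h x \<noteq> h y"
  shows "Hausdorff_space Y"
  unfolding Hausdorff_space_def
proof (intro allI impI)
  fix a b assume ab: "a \<in> topspace Y \<and> b \<in> topspace Y \<and> a \<noteq> b"
  obtain x y where xy: "x \<in> topspace X" "y \<in> topspace X" "a = q x" "b = q y"
    using ab quotient_imp_surjective_map[OF q] by (metis imageE)
  then have "q x \<noteq> q y"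
    using ab by simp
  from sep[OF xy(1,2) this] obtain h where h: "continuous_map X euclideanreal h"
    "\<And>u v. u \<in> topspace X \<Longrightarrow> v \<in> topspace X \<Longrightarrow> q u = q v \<Longrightarrow> h u = h v" "h x \<noteq> h y"
    by (elim exE conjE) (use that in blast)
  obtain g where g: "continuous_map Y euclideanreal g" "\<And>x. x \<in> topspace X \<Longrightarrow> g (q x) = h x"
    by (rule quotient_map_lift_exists[OF q h(1,2)]) (auto intro!: that)
  have "g a \<noteq> g b"
    using g(2)[OF xy(1)] g(2)[OF xy(2)] xy(3,4) h(3) by simp
  then obtain A B where AB: "open A" "open B" "g a \<in> A" "g b \<in> B" "A \<inter> B = {}"
    using hausdorff[of "g a" "g b"] by blast
  have "openin Y {c \<in> topspace Y. g c \<in> A}" "openin Y {c \<in> topspace Y. g c \<in> B}"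
    using AB(1,2) by (simp_all add: openin_continuous_map_preimage[OF g(1)])
  moreover have "disjnt {c \<in> topspace Y. g c \<in> A} {c \<in> topspace Y. g c \<in> B}"
    using AB(5) by (auto simp: disjnt_iff)
  ultimately show "\<exists>U V. openin Y U \<and> openin Y V \<and> a \<in> U \<and> b \<in> V \<and> disjnt U V"
    using ab AB(3,4) by (intro exI conjI) simp_all
qed

text \<open>
  The entries of the matrix of orthogonal projection onto the line spanned by one block of \<open>x\<close>; in the
  first block the scalar product is the bilinear one over the dual numbers.
\<close>

definition dual_invariant :: "nat \<Rightarrow> nat \<Rightarrow> nat \<Rightarrow> tuple \<Rightarrow> dual" where
  "dual_invariant n i k x = x i * x k * inverse (\<Sum>l\<le>n. x l * x l)"

definition real_invariant :: "nat \<Rightarrow> nat \<Rightarrow> nat \<Rightarrow> nat \<Rightarrow> tuple \<Rightarrow> real" where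
  "real_invariant n m i k x =
     ze (x (n + 1 + i)) * ze (x (n + 1 + k)) *
       inverse (\<Sum>l\<le>m. ze (x (n + 1 + l)) * ze (x (n + 1 + l)))"

lemma punctured_sums_nonzero:
  assumes "x \<in> zd_punctured n m"
  shows "re (\<Sum>l\<le>n. x l * x l) \<noteq> 0" "(\<Sum>l\<le>m. ze (x (n + 1 + l)) * ze (x (n + 1 + l))) \<noteq> 0"
  using assms
  by (auto simp: re_sum_dual sum_nonneg_eq_0_iff zd_punctured_def zd_V_def zd_W_def)

lemma inverse_mult_dual:
  fixes x y :: dual
  shows "inverse (x * y) = inverse x * inverse y"
  by (cases "re x = 0"; cases "re y = 0") (simp_all add: dual_eq_iff divide_simps)

text \<open>
  Numerator and denominator are quadratic, so a factor \<open>s\<close> or \<open>t\<close> cancels in the quotient.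
\<close>

lemma invariants_rel:
  assumes "(x, y) \<in> proj_rel n m"
  shows "i \<le> n \<Longrightarrow> k \<le> n \<Longrightarrow> dual_invariant n i k y = dual_invariant n i k x"
    and "i \<le> m \<Longrightarrow> k \<le> m \<Longrightarrow> real_invariant n m i k y = real_invariant n m i k x"
proof -
  obtain s t where st: "re s \<noteq> 0" "t \<noteq> 0" "\<And>i. i \<le> n \<Longrightarrow> y i = s * x i"
    "\<And>j. j \<le> m \<Longrightarrow> ze (y (n + 1 + j)) = t * ze (x (n + 1 + j))"
    using assms by (auto simp: proj_rel_def)
  have "(\<Sum>l\<le>n. y l * y l) = s * s * (\<Sum>l\<le>n. x l * x l)"
    by (simp add: st sum_distrib_left mult_ac)
  then have "dual_invariant n i k y = (s * inverse s) * (s * inverse s) * dual_invariant n i k x"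
    if "i \<le> n" "k \<le> n"
    using that by (simp only: dual_invariant_def st(3) inverse_mult_dual mult_ac)
  then show "dual_invariant n i k y = dual_invariant n i k x" if "i \<le> n" "k \<le> n"
    using that st(1) by (simp add: inverse_dual)
  have "(\<Sum>l\<le>m. ze (y (n + 1 + l)) * ze (y (n + 1 + l))) =
      t * t * (\<Sum>l\<le>m. ze (x (n + 1 + l)) * ze (x (n + 1 + l)))"
    unfolding sum_distrib_left by (intro sum.cong refl) (simp only: st(4) atMost_iff mult_ac)
  then have "real_invariant n m i k y = (t * inverse t) * (t * inverse t) * real_invariant n m i k x"
    if "i \<le> m" "k \<le> m"
    using that by (simp only: real_invariant_def st(4) inverse_mult_distrib mult_ac)
  then show "real_invariant n m i k y = real_invariant n m i k x" if "i \<le> m" "k \<le> m"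
    using that st(2) by simp
qed

text \<open>
  If \<open>x i\<close> is invertible, then equality of the invariants at \<open>(i, i)\<close> makes \<open>y i\<close> invertible, and
  their equality at \<open>(i, k)\<close> can then be solved for \<open>y k\<close>, giving a multiple of \<open>x k\<close> by a factor
  independent of \<open>k\<close>.  The real block is treated in the same way.
\<close>

lemma invariants_separate:
  assumes x: "x \<in> zd_punctured n m" and y: "y \<in> zd_punctured n m"
    and D: "\<And>i k. i \<le> n \<Longrightarrow> k \<le> n \<Longrightarrow> dual_invariant n i k x = dual_invariant n i k y"
    and R: "\<And>i k. i \<le> m \<Longrightarrow> k \<le> m \<Longrightarrow> real_invariant n m i k x = real_invariant n m i k y"
  shows "(x, y) \<in> proj_rel n m"
proof -
  define P Q where "P = inverse (\<Sum>l\<le>n. x l * x l)" and "Q = inverse (\<Sum>l\<le>n. y l * y l)"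
  define p q where "p = inverse (\<Sum>l\<le>m. ze (x (n + 1 + l)) * ze (x (n + 1 + l)))"
    and "q = inverse (\<Sum>l\<le>m. ze (y (n + 1 + l)) * ze (y (n + 1 + l)))"
  have nz: "re P \<noteq> 0" "re Q \<noteq> 0" "p \<noteq> 0" "q \<noteq> 0"
    using punctured_sums_nonzero[OF x] punctured_sums_nonzero[OF y]
    by (simp_all add: P_def Q_def p_def q_def)
  obtain i j where i: "i \<le> n" "re (x i) \<noteq> 0" and j: "j \<le> m" "ze (x (n + 1 + j)) \<noteq> 0"
    using x by (auto simp: zd_punctured_def zd_V_def zd_W_def)
  have D': "x i * x k * P = y i * y k * Q" if "k \<le> n" for k
    using D[OF i(1) that] by (simp add: dual_invariant_def P_def Q_def)
  have R': "ze (x (n + 1 + j)) * ze (x (n + 1 + l)) * p = ze (y (n + 1 + j)) * ze (y (n + 1 + l)) * q"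
    if "l \<le> m" for l
    using R[OF j(1) that] by (simp only: real_invariant_def p_def q_def)
  have yi: "re (y i) \<noteq> 0"
    using D'[OF i(1)] i nz by (auto simp: dual_eq_iff)
  have yj: "ze (y (n + 1 + j)) \<noteq> 0"
    using R'[OF j(1)] j nz by auto
  define s where "s = x i * P * inverse (y i * Q)"
  define t where "t = ze (x (n + 1 + j)) * p / (ze (y (n + 1 + j)) * q)"
  have "y k = s * x k" if "k \<le> n" for k
  proof -
    have "s * x k = (x i * x k * P) * inverse (y i * Q)"
      by (simp add: s_def mult_ac)
    also have "\<dots> = y k * ((y i * Q) * inverse (y i * Q))"
      unfolding D'[OF that] by (simp only: mult_ac)
    also have "\<dots> = y k"
      using yi nz inverse_dual[of "y i * Q"] by simp
    finally show ?thesis ..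
  qed
  moreover have "ze (y (n + 1 + l)) = t * ze (x (n + 1 + l))" if "l \<le> m" for l
    using R'[OF that] yj nz by (simp add: t_def field_simps)
  moreover have "re s \<noteq> 0" "t \<noteq> 0"
    using i j yi yj nz by (simp_all add: s_def t_def)
  ultimately show ?thesis
    unfolding proj_rel_def using x y by blast
qed

lemma Hausdorff_proj_module: "Hausdorff_space (proj_module n m)"
proof -
  let ?Z = "zd_punctured n m"
  let ?X = "subtopology (zd_topology (n + 1) (m + 1)) ?Z"
  have rat: "rational_on ?Z (\<lambda>x. re (dual_invariant n i k x))"
    "rational_on ?Z (\<lambda>x. ze (dual_invariant n i k x))" for i k
  proof -
    have "dual_rational_on ?Z (dual_invariant n i k)"
      unfolding dual_invariant_def
      by (intro dual_rational_onI dual_rational_on_sum punctured_sums_nonzero)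
    then show "rational_on ?Z (\<lambda>x. re (dual_invariant n i k x))"
      "rational_on ?Z (\<lambda>x. ze (dual_invariant n i k x))"
      by (auto simp: dual_rational_on_def)
  qed
  have rat': "rational_on ?Z (real_invariant n m i k)" for i k
    unfolding real_invariant_def
    by (intro rational_on.intros rational_on_sum punctured_sums_nonzero)
  show ?thesis
    unfolding proj_module_def
  proof (rule Hausdorff_space_quotient_map[OF quotient_map_quotient_topology], unfold topspace_punctured)
    fix x y assume xy: "x \<in> ?Z" "y \<in> ?Z" and "proj_rel n m `` {x} \<noteq> proj_rel n m `` {y}"
    then have "(x, y) \<notin> proj_rel n m"
      using equiv_class_eq[OF equiv_proj_rel] by blast
    then consider
        i k where "i \<le> n" "k \<le> n" "dual_invariant n i k x \<noteq> dual_invariant n i k y"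
      | i k where "i \<le> m" "k \<le> m" "real_invariant n m i k x \<noteq> real_invariant n m i k y"
      using invariants_separate[OF xy] by blast
    then have "\<exists>h. rational_on ?Z h \<and> (\<forall>u v. (u, v) \<in> proj_rel n m \<longrightarrow> h v = h u) \<and> h x \<noteq> h y"
    proof cases
      case 1
      then show ?thesis
        unfolding dual_eq_iff using rat[of i k] invariants_rel(1)[OF _ 1(1,2)] by metis
    next
      case 2
      then show ?thesis
        using rat'[of i k] invariants_rel(2)[OF _ 2(1,2)] by metis
    qed
    moreover have "(u, v) \<in> proj_rel n m"
      if "u \<in> ?Z" "v \<in> ?Z" "proj_rel n m `` {u} = proj_rel n m `` {v}" for u v
      using eq_equiv_class_iff[OF equiv_proj_rel that(1,2)] that(3) by blast
    ultimately show "\<exists>h. continuous_map ?X euclideanreal h \<and>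
        (\<forall>u\<in>?Z. \<forall>v\<in>?Z. proj_rel n m `` {u} = proj_rel n m `` {v} \<longrightarrow> h u = h v) \<and> h x \<noteq> h y"
      using rational_on_continuous by metis
  qed
qed

theorem mainTheorem4:
  fixes n m :: nat
  assumes "n + m \<noteq> 0"
  shows "zd_smooth_atlas n m (proj_module n m)
           {(proj_U n m i j, proj_chart n m i j) | i j. i \<le> n \<and> j \<le> m}
         \<and> zd_smooth_manifold n m (proj_module n m)"
  unfolding zd_smooth_manifold_def using proj_atlas Hausdorff_proj_module by blast

end
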